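(* Let $A=\begin{pmatrix} B & E\\ F & C\end{pmatrix}\in\mathbb{R}^{n\times n}$ be any matrix partitioned as described in the context, such that $B$, $C_0$ and the Schur complement $S=C-FB^{-1}E$ are nonsingular, and let $E_s=C_0-S$. For every integer $m\ge 0$, the matrix $$E_{rr}(m):=S\widehat{R},\qquad \widehat{R}=S^{-1}-\sum_{i=0}^{m}(C_0^{-1}E_s)^i C_0^{-1},$$ satisfies $$E_{rr}(m)=(E_sC_0^{-1})^{m+1}.$$
   Context: $A\in\mathbb{R}^{n\times n}$ is written in $2\times 2$ block form with $B\in\mathbb{R}^{p\times p}$, $E\in\mathbb{R}^{p\times q}$, $F\in\mathbb{R}^{q\times p}$, $C\in\mathbb{R}^{q\times q}$, $p+q=n$. Here $B=\mathrm{diag}(B_1,\dots,B_s)$ is block diagonal with $s$ square blocks, $E=\mathrm{diag}(E_1,\dots,E_s)$ is block diagonal with conforming (possibly rectangular) blocks, $F$ has the same block structure as $E^T$, and $C=(C_{ij})_{i,j=1}^s$ is partitioned conformally into blocks with square diagonal blocks $C_{ii}=:C_i$. (This arises from reordering a sparse matrix by a graph partitioning into $s$ subdomains, with interface variables labeled last.) $C_0=\mathrm{diag}(C_1,\dots,C_s)$ denotes the block diagonal part of $C$. The matrix $E_s$ (subscript $s$ for the splitting $S=C_0-E_s$) is not to be confused with the block of $E$ carrying the same symbol. *)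

theory Defs
  imports
    "Jordan_Normal_Form.Gauss_Jordan_Elimination"
    "HOL-Algebra.Ring"
begin

text \<open>Block sizes are given as lists of naturals; size \<open>0\<close> is allowed. Block indices and matrix
  indices start at \<open>0\<close>.\<close>

text \<open>Only meaningful for nonsingular square matrices: \<^const>\<open>mat_inverse\<close> returns \<^const>\<open>None\<close>
  otherwise.\<close>

definition inv_mat :: "real mat \<Rightarrow> real mat" where
  "inv_mat M = the (mat_inverse M)"

text \<open>\<^const>\<open>diag_block_mat\<close> also accepts rectangular blocks, and the equations for the dimensions
  force \<open>rs\<close> and \<open>cs\<close> to have the same length.\<close>

definition block_diagonal :: "nat list \<Rightarrow> nat list \<Rightarrow> real mat \<Rightarrow> bool" where
  "block_diagonal rs cs M \<longleftrightarrow>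
     (\<exists>Ms. map dim_row Ms = rs \<and> map dim_col Ms = cs \<and> M = diag_block_mat Ms)"

definition block_of :: "nat list \<Rightarrow> real mat \<Rightarrow> nat \<Rightarrow> nat \<Rightarrow> real mat" where
  "block_of qs M i j =
     mat (qs ! i) (qs ! j)
       (\<lambda>(a, b). M $$ (sum_list (take i qs) + a, sum_list (take j qs) + b))"

definition block_diag_part :: "nat list \<Rightarrow> real mat \<Rightarrow> real mat" where
  "block_diag_part qs M = diag_block_mat (map (\<lambda>i. block_of qs M i i) [0..<length qs])"

definition schur_complement :: "real mat \<Rightarrow> real mat \<Rightarrow> real mat \<Rightarrow> real mat \<Rightarrow> real mat" where
  "schur_complement B E F C = C - F * inv_mat B * E"

end

theory Submission
  imports Defs
begin

text \<open>Since \<open>S = C\<^sub>0 - E\<^sub>s\<close>, the matrix \<open>S C\<^sub>0\<^sup>-\<^sup>1 = 1 - E\<^sub>s C\<^sub>0\<^sup>-\<^sup>1\<close>, so pushing \<open>C\<^sub>0\<^sup>-\<^sup>1\<close> to the left through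
  the powers turns \<open>S\<close> times the truncated Neumann series into a telescoping sum.\<close>

text \<open>\<open>invertible_mat\<close> supplies a two-sided inverse, so \<open>M\<close> is a
  unit of the ring of n by n matrices. On units \<open>mat_inverse\<close> does not return
  \<open>None\<close>, hence \<open>the\<close> in \<open>inv_mat\<close> picks a genuine
  inverse.\<close>

lemma inv_mat_inverse:
  assumes M: "M \<in> carrier_mat n n" and inv: "invertible_mat M"
  shows "inv_mat M \<in> carrier_mat n n" and "M * inv_mat M = 1\<^sub>m n"
proof -
  obtain N where "inverts_mat M N" and "inverts_mat N M"
    using inv unfolding invertible_mat_def by blast
  hence MN: "M * N = 1\<^sub>m n" and NM: "N * M = 1\<^sub>m (dim_row N)"
    using M unfolding inverts_mat_def by auto
  \<comment> \<open>\<open>inverts_mat\<close> leaves the shape of \<open>N\<close> open; comparing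
    column counts in both product equations forces it to be square of size n.\<close>
  have "dim_col N = n" using arg_cong[OF MN, of dim_col] by simp
  moreover have "dim_row N = n" using arg_cong[OF NM, of dim_col] M by simp
  ultimately have N: "N \<in> carrier_mat n n" by auto
  have "mat_inverse M \<noteq> None"
    using mat_inverse(1)[OF M, of "()"] M N MN NM
    by (auto simp: Units_def ring_mat_simps)
  then obtain K where "mat_inverse M = Some K" by auto
  with mat_inverse(2)[OF M this]
  show "inv_mat M \<in> carrier_mat n n" "M * inv_mat M = 1\<^sub>m n"
    by (auto simp: inv_mat_def)
qed

lemma block_diagonal_carrier:
  assumes "block_diagonal rs cs M"
  shows "M \<in> carrier_mat (sum_list rs) (sum_list cs)"
  using assms unfolding block_diagonal_def by (auto simp: dim_diag_block_mat)

lemma block_diag_part_carrier: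
  "block_diag_part qs M \<in> carrier_mat (sum_list qs) (sum_list qs)"
proof -
  have "map dim_row (map (\<lambda>i. block_of qs M i i) [0..<length qs]) = qs"
    "map dim_col (map (\<lambda>i. block_of qs M i i) [0..<length qs]) = qs"
    by (simp_all add: block_of_def comp_def map_nth)
  thus ?thesis
    unfolding block_diag_part_def by (intro carrier_matI) (simp_all only: dim_diag_block_mat)
qed

text \<open>Pure reassociation: each (DG)D equals D(GD), so D passes through the factors of the
  power one at a time.\<close>

lemma pow_mat_shift:
  fixes D G :: "'a :: semiring_1 mat"
  assumes D: "D \<in> carrier_mat n n" and G: "G \<in> carrier_mat n n"
  shows "(D * G) ^\<^sub>m i * D = D * (G * D) ^\<^sub>m i"
proof (induction i)
  case 0
  show ?case using D G by simp
next
  case (Suc i)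
  have X: "(D * G) ^\<^sub>m i \<in> carrier_mat n n" and Y: "(G * D) ^\<^sub>m i \<in> carrier_mat n n"
    using D G by (auto intro!: pow_carrier_mat)
  \<comment> \<open>\<open>pow_mat\<close> appends the new factor on the right, so it stands next to
    the trailing \<open>D\<close> and can be regrouped before the induction hypothesis is
    used.\<close>
  have "(D * G) ^\<^sub>m Suc i * D = ((D * G) ^\<^sub>m i * D) * (G * D)"
    using D G X by (simp add: assoc_mult_mat[of _ n n _ n _ n])
  also have "\<dots> = D * (G * D) ^\<^sub>m Suc i"
    using D G Y Suc.IH by (simp add: assoc_mult_mat[of _ n n _ n _ n])
  finally show ?case .
qed

text \<open>In the application \<open>K\<close> is \<open>C0\<close>, \<open>D\<close> its inverse
  and \<open>G\<close> is \<open>Es\<close>. After the shift each summand begins with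
  \<open>D\<close>, and (K - G)D = 1 - GD makes the product a difference of consecutive powers of
  GD.\<close>

lemma mult_truncated_neumann:
  fixes K D G :: "'a :: ring_1 mat"
  assumes K: "K \<in> carrier_mat n n" and D: "D \<in> carrier_mat n n" and G: "G \<in> carrier_mat n n"
    and KD: "K * D = 1\<^sub>m n"
  shows "(K - G) * (\<Oplus>\<^bsub>ring_mat TYPE('a) n ()\<^esub>i\<in>{0..m}. (D * G) ^\<^sub>m i * D)
    = 1\<^sub>m n - (G * D) ^\<^sub>m (m + 1)"
proof -
  interpret R: semiring "ring_mat TYPE('a) n ()" by (rule semiring_mat)
  define f where "f = (\<lambda>i. (D * G) ^\<^sub>m i * D)"
  have Y: "(G * D) ^\<^sub>m i \<in> carrier_mat n n" for i
    using D G by (auto intro!: pow_carrier_mat)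
  have f: "f i \<in> carrier_mat n n" for i
    using D G unfolding f_def by (auto intro!: mult_carrier_mat pow_carrier_mat)
  hence f_Pi: "f \<in> A \<rightarrow> carrier (ring_mat TYPE('a) n ())" for A
    by (simp add: ring_mat_simps)
  \<comment> \<open>The index set \<open>{..m}\<close> is the form that \<open>finsum_Suc\<close>
    expects; \<open>atLeast0AtMost\<close> reconciles it with \<open>{0..m}\<close> at the
    end.\<close>
  define T where "T = (\<lambda>m. \<Oplus>\<^bsub>ring_mat TYPE('a) n ()\<^esub>i\<in>{..m}. f i)"
  have T: "T k \<in> carrier_mat n n" for k
    using R.finsum_closed[OF f_Pi] by (simp add: T_def ring_mat_simps)
  have step: "(K - G) * f i = (G * D) ^\<^sub>m i - (G * D) ^\<^sub>m (Suc i)" for i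
  proof -
    have "(K - G) * f i = ((K - G) * D) * (G * D) ^\<^sub>m i"
      unfolding f_def pow_mat_shift[OF D G]
      using D G K Y by (simp add: minus_carrier_mat assoc_mult_mat[of _ n n _ n _ n])
    also have "(K - G) * D = 1\<^sub>m n - G * D"
      using D G K by (simp add: minus_mult_distrib_mat KD)
    also have "(1\<^sub>m n - G * D) * (G * D) ^\<^sub>m i = (G * D) ^\<^sub>m i - G * D * (G * D) ^\<^sub>m i"
      using D G Y[of i]
        minus_mult_distrib_mat[OF one_carrier_mat mult_carrier_mat[OF G D] Y[of i]] by simp
    \<comment> \<open>The distributive law leaves the base on the left of its power. Shifting with
      \<open>G * D\<close> and the identity as the two factors says that a power commutes with its
      base.\<close>
    also have "G * D * (G * D) ^\<^sub>m i = (G * D) ^\<^sub>m (Suc i)"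
      using pow_mat_shift[of "G * D" n "1\<^sub>m n" i] D G Y by simp
    finally show ?thesis .
  qed
  have "(K - G) * T m = 1\<^sub>m n - (G * D) ^\<^sub>m (Suc m)"
  proof (induction m)
    case 0
    have "T 0 = f 0"
      using f[of 0] by (simp add: T_def f_Pi ring_mat_simps)
    thus ?case using step[of 0] D G by simp
  next
    case (Suc m)
    have "T (Suc m) = f (Suc m) + T m"
      unfolding T_def by (subst R.finsum_Suc[OF f_Pi]) (simp add: ring_mat_simps)
    hence "(K - G) * T (Suc m) = (K - G) * f (Suc m) + (K - G) * T m"
      using mult_add_distrib_mat[OF minus_carrier_mat[OF G] f T] by simp
    also have "\<dots> = ((G * D) ^\<^sub>m Suc m - (G * D) ^\<^sub>m Suc (Suc m)) + (1\<^sub>m n - (G * D) ^\<^sub>m Suc m)"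
      by (simp only: step Suc.IH)
    \<comment> \<open>The cancellation is checked entrywise; the powers must stay folded so that
      they are treated as opaque matrices of known size.\<close>
    also have "\<dots> = 1\<^sub>m n - (G * D) ^\<^sub>m Suc (Suc m)"
      using Y[of "Suc m"] Y[of "Suc (Suc m)"] by (intro eq_matI) (auto simp del: pow_mat.simps)
    finally show ?case .
  qed
  thus ?thesis by (simp add: T_def f_def atLeast0AtMost)
qed

theorem theorem3p3:
  fixes A B E F C C0 S Es :: "real mat"
    and Rhat Err :: "nat \<Rightarrow> real mat"
    and n p q s :: nat
    and ps qs :: "nat list"
  assumes "length ps = s" and "length qs = s"
    and "p = sum_list ps" and "q = sum_list qs" and "n = p + q"
    and "A \<in> carrier_mat n n"
    and "A = four_block_mat B E F C"
    and "block_diagonal ps ps B"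
    and "block_diagonal ps qs E"
    and "block_diagonal qs ps F"
    and "C \<in> carrier_mat q q"
    and "C0 = block_diag_part qs C"
    and "S = schur_complement B E F C"
    and "invertible_mat B" and "invertible_mat C0" and "invertible_mat S"
    and "Es = C0 - S"
    and "\<And>m. Rhat m = inv_mat S -
           (\<Oplus>\<^bsub>ring_mat TYPE(real) q ()\<^esub>i\<in>{0..m}. (inv_mat C0 * Es) ^\<^sub>m i * inv_mat C0)"
    and "\<And>m. Err m = S * Rhat m"
  shows "\<forall>m. Err m = (Es * inv_mat C0) ^\<^sub>m (m + 1)"
proof
  fix m
  have dims: "B \<in> carrier_mat p p" "E \<in> carrier_mat p q" "F \<in> carrier_mat q p"
    using assms block_diagonal_carrier by blast+
  have C0: "C0 \<in> carrier_mat q q" using assms block_diag_part_carrier by blast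
  have "F * inv_mat B * E \<in> carrier_mat q q"
    using dims inv_mat_inverse(1)[OF dims(1) \<open>invertible_mat B\<close>] by auto
  \<comment> \<open>A matrix difference takes its dimensions from the second operand, here the
    product just shown to be q by q.\<close>
  hence S: "S \<in> carrier_mat q q"
    unfolding assms(13) schur_complement_def by (rule minus_carrier_mat)
  have Es: "Es \<in> carrier_mat q q" using assms(17) S by auto
  note invS = inv_mat_inverse[OF S \<open>invertible_mat S\<close>]
  note invC0 = inv_mat_inverse[OF C0 \<open>invertible_mat C0\<close>]
  interpret R: semiring "ring_mat TYPE(real) q ()" by (rule semiring_mat)
  let ?T = "\<Oplus>\<^bsub>ring_mat TYPE(real) q ()\<^esub>i\<in>{0..m}. (inv_mat C0 * Es) ^\<^sub>m i * inv_mat C0"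
  have "(inv_mat C0 * Es) ^\<^sub>m i * inv_mat C0 \<in> carrier_mat q q" for i
    using invC0(1) Es by (auto intro!: mult_carrier_mat pow_carrier_mat)
  hence T: "?T \<in> carrier_mat q q"
    using R.finsum_closed[of "\<lambda>i. (inv_mat C0 * Es) ^\<^sub>m i * inv_mat C0" "{0..m}"]
    by (simp add: ring_mat_simps)
  have Y: "(Es * inv_mat C0) ^\<^sub>m (m + 1) \<in> carrier_mat q q"
    using invC0(1) Es by (intro pow_carrier_mat) auto
  \<comment> \<open>This reads the definition of \<open>Es\<close> backwards as the splitting of
    \<open>S\<close>, the form in which the truncated series lemma applies.\<close>
  have "C0 - Es = S" unfolding assms(17) using C0 S by (intro eq_matI) auto
  with mult_truncated_neumann[OF C0 invC0(1) Es invC0(2), of m]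
  have ST: "S * ?T = 1\<^sub>m q - (Es * inv_mat C0) ^\<^sub>m (m + 1)" by simp
  \<comment> \<open>The exact inverse contributes the identity and the truncated series the identity
    minus a power, so only that power survives.\<close>
  have "Err m = S * inv_mat S - S * ?T"
    unfolding assms(18,19) by (rule mult_minus_distrib_mat[OF S invS(1) T])
  also have "\<dots> = 1\<^sub>m q - (1\<^sub>m q - (Es * inv_mat C0) ^\<^sub>m (m + 1))"
    by (simp only: invS(2) ST)
  also have "\<dots> = (Es * inv_mat C0) ^\<^sub>m (m + 1)"
    using Y by (intro eq_matI) (auto simp del: pow_mat.simps)
  finally show "Err m = (Es * inv_mat C0) ^\<^sub>m (m + 1)" .
qed

end
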